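(* Let $V$ be the vertex set of a finite simple graph and fix an edge $\{u,v\}$. Let $s:\mathbb{Z}^V\to\{u,v\}$ be a translation-invariant deterministic selector, and let $$T(x)=x+e_{s(x)},\qquad x\in\mathbb{Z}^V.$$ Then $$T(x+e_z)-T(x)\in\{e_w:w\in V\}$$ for every profile $x\in\mathbb{Z}^V$ and every vertex $z\in V$ if and only if $s(x)$ depends only on $x_u-x_v$ and the function $$d\longmapsto \mathbf{1}_{\{s(x)=u\}},\qquad d=x_u-x_v,$$ is nonincreasing.
   Context: Profiles are integer vectors $x\in\mathbb{Z}^V$; $e_w\in\mathbb{Z}^V$ is the standard basis vector at $w$. Translation invariance of $s$ means $s(x+k\mathbf{1})=s(x)$ for all $x\in\mathbb{Z}^V$ and $k\in\mathbb{Z}$, where $\mathbf 1$ is the all-ones vector. *)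

theory Defs
  imports "HOL-Analysis.Finite_Cartesian_Product" "HOL-Analysis.Cartesian_Space"
    "Graph_Theory.Pair_Digraph"
begin

text \<open>
  The vertex set is a finite type \<open>'v\<close>, and a profile is an element of \<open>int ^ 'v\<close>; the standard
  basis vector at \<open>w\<close> is \<open>axis w 1\<close>, and the all-ones vector is \<open>1\<close>.
\<close>

definition translation_invariant :: "(int ^ 'v::finite \<Rightarrow> 'v) \<Rightarrow> bool" where
  "translation_invariant s \<longleftrightarrow> (\<forall>x k. s (x + k *s 1) = s x)"

definition selector_step :: "(int ^ 'v::finite \<Rightarrow> 'v) \<Rightarrow> int ^ 'v \<Rightarrow> int ^ 'v" where
  "selector_step s x = x + axis (s x) 1"

text \<open>
  The function \<open>d \<mapsto> 1[s(x) = u]\<close> makes sense only once \<open>s\<close> factors through \<open>d = x\<^sub>u - x\<^sub>v\<close>, so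
  monotonicity is stated for the factor \<open>f\<close>.  For \<open>u \<noteq> v\<close> every integer is such a difference, hence
  \<open>f\<close> is unique.
\<close>

definition nonincreasing_in_difference ::
  "'v::finite \<Rightarrow> 'v \<Rightarrow> (int ^ 'v \<Rightarrow> 'v) \<Rightarrow> bool" where
  "nonincreasing_in_difference u v s \<longleftrightarrow>
    (\<exists>f :: int \<Rightarrow> 'v. (\<forall>x. s x = f (x $ u - x $ v)) \<and>
       antimono (\<lambda>d. of_bool (f d = u) :: int))"

end

theory Submission
  imports Defs
begin

text \<open>
  Since \<open>T(x + e\<^sub>z) - T(x) = e\<^sub>z + e\<^bsub>s(x + e\<^sub>z)\<^esub> - e\<^bsub>s(x)\<^esub>\<close>, the condition says that adding \<open>e\<^sub>z\<close>
  may change the selection only if \<open>z\<close> itself was selected.  Coordinates other than \<open>u\<close> and \<open>v\<close> are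
  therefore irrelevant, and translation invariance then leaves only \<open>x\<^sub>u - x\<^sub>v\<close>.  Adding \<open>e\<^sub>u\<close> or \<open>e\<^sub>v\<close>
  moves this difference by one, up or down, which gives the monotonicity.
\<close>

text \<open>Look at coordinate \<open>b\<close>: if \<open>b\<close> is neither \<open>a\<close> nor
  \<open>z\<close>, the left side is -1 there, while a basis vector has only entries 0 and 1.
  Conversely, \<open>axis b 1\<close> cancels one of the two positive terms and leaves the
  other.\<close>

lemma axis_add_diff_is_axis_iff:
  fixes z a b :: "'v::finite"
  shows "(\<exists>w. axis z (1::int) + axis a 1 - axis b 1 = axis w 1) \<longleftrightarrow> a = b \<or> b = z"
proof
  assume "\<exists>w. axis z (1::int) + axis a 1 - axis b 1 = axis w 1"
  then obtain w where w: "axis z (1::int) + axis a 1 - axis b 1 = axis w 1" by blast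
  have "(axis z (1::int) + axis a 1 - axis b 1) $ b = axis w 1 $ b" by (simp only: w)
  then show "a = b \<or> b = z" by (auto simp: axis_def split: if_splits)
qed auto

lemma selector_step_condition_iff:
  fixes s :: "int ^ 'v::finite \<Rightarrow> 'v"
  shows "selector_step s (x + axis z 1) - selector_step s x \<in> {axis w 1 | w. w \<in> UNIV}
    \<longleftrightarrow> s (x + axis z 1) = s x \<or> s x = z"
proof -
  have "selector_step s (x + axis z 1) - selector_step s x
      = axis z 1 + axis (s (x + axis z 1)) 1 - axis (s x) 1"
    by (simp add: selector_step_def)
  then show ?thesis
    using axis_add_diff_is_axis_iff[of z "s (x + axis z 1)" "s x"] by auto
qed

text \<open>Invariance is assumed at every profile, so a unit step can also be undone; this covers
  negative \<open>c\<close>.\<close>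

lemma invariant_add_multiple:
  fixes g :: "int ^ 'v::finite \<Rightarrow> 'a"
  assumes "\<And>x. g (x + axis z 1) = g x"
  shows "g (x + c *s axis z 1) = g x"
proof (induction c rule: int_induct[of _ 0])
  case base
  then show ?case by simp
next
  case (step1 i)
  have "x + (i + 1) *s axis z 1 = (x + i *s axis z 1) + axis z 1"
    by (simp add: vector_sadd_rdistrib)
  then show ?case using step1 assms by metis
next
  case (step2 i)
  have "x + i *s axis z 1 = (x + (i - 1) *s axis z 1) + axis z 1"
    by (simp add: vector_ssub_ldistrib vec_eq_iff algebra_simps)
  then show ?case using step2 assms by metis
qed

lemma invariant_add_combination:
  fixes g :: "int ^ 'v::finite \<Rightarrow> 'a"
  assumes "\<And>x z. z \<in> A \<Longrightarrow> g (x + axis z 1) = g x"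
  shows "g (x + (\<Sum>z\<in>A. c z *s axis z 1)) = g x"
proof -
  have "finite A" by simp
  then show ?thesis using assms
  proof (induction A arbitrary: x rule: finite_induct)
    case (insert a A)
    have "g (x + (\<Sum>z\<in>insert a A. c z *s axis z 1))
        = g ((x + c a *s axis a 1) + (\<Sum>z\<in>A. c z *s axis z 1))"
      using insert.hyps by (simp add: add.assoc)
    also have "\<dots> = g (x + c a *s axis a 1)" using insert by blast
    also have "\<dots> = g x" using insert.prems by (intro invariant_add_multiple) blast
    finally show ?case .
  qed simp
qed

lemma translation_invariant_factors_through_difference:
  fixes s :: "int ^ 'v::finite \<Rightarrow> 'v"
  assumes "translation_invariant s" and "u \<noteq> v"
    and other: "\<And>x z. z \<notin> {u, v} \<Longrightarrow> s (x + axis z 1) = s x"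
  shows "s x = s ((x $ u - x $ v) *s axis u 1)"
proof -
  \<comment> \<open>Translation by the multiple of the all-ones vector that makes coordinate
    \<open>v\<close> zero. Coordinate \<open>u\<close> becomes the difference, and the coordinates
    outside \<open>{u, v}\<close> can then be dropped by \<open>other\<close>.\<close>
  define y where "y = x + (- (x $ v)) *s 1"
  have "y = (\<Sum>z\<in>UNIV. y $ z *s axis z 1)" by (simp add: basis_expansion)
  also have "\<dots> = (\<Sum>z\<in>{u, v}. y $ z *s axis z 1) + (\<Sum>z\<in>UNIV - {u, v}. y $ z *s axis z 1)"
    by (metis (no_types, lifting) add.commute finite sum.subset_diff subset_UNIV)
  also have "(\<Sum>z\<in>{u, v}. y $ z *s axis z 1) = (x $ u - x $ v) *s axis u 1"
    using \<open>u \<noteq> v\<close> by (simp add: y_def)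
  finally have "s y = s ((x $ u - x $ v) *s axis u 1)"
    using invariant_add_combination[of "UNIV - {u, v}" s] other by (metis DiffD2)
  moreover have "s y = s x"
    using assms(1) by (simp only: translation_invariant_def y_def)
  ultimately show ?thesis by simp
qed

text \<open>On the integers, monotonicity reduces to unit steps, which is exactly what adding one
  basis vector tests.\<close>

lemma antimono_of_bool_int_iff:
  fixes P :: "int \<Rightarrow> bool"
  shows "antimono (\<lambda>d. of_bool (P d) :: int) \<longleftrightarrow> (\<forall>d. P (d + 1) \<longrightarrow> P d)"
proof
  assume "antimono (\<lambda>d. of_bool (P d) :: int)"
  then have "of_bool (P (d + 1)) \<le> (of_bool (P d) :: int)" for d by (rule antimonoD) simp
  then show "\<forall>d. P (d + 1) \<longrightarrow> P d" by (metis of_bool_eq not_one_le_zero)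
next
  assume step: "\<forall>d. P (d + 1) \<longrightarrow> P d"
  have "P b \<longrightarrow> P a" if "a \<le> b" for a b
    using that by (induction b rule: int_ge_induct) (use step in auto)
  then show "antimono (\<lambda>d. of_bool (P d) :: int)" by (auto intro!: antimonoI)
qed

theorem proposition2p1:
  fixes G :: "'v::finite pair_pre_digraph"
    and u v :: 'v
    and s :: "int ^ 'v \<Rightarrow> 'v"
  assumes "pair_graph G"
    and "pverts G = UNIV"
    and "(u, v) \<in> parcs G"
    and "\<forall>x. s x \<in> {u, v}"
    and "translation_invariant s"
  shows "(\<forall>x z. selector_step s (x + axis z 1) - selector_step s x \<in> {axis w 1 | w. w \<in> pverts G})
    \<longleftrightarrow> nonincreasing_in_difference u v s"
proof -
  interpret pair_graph G by fact
  have "u \<noteq> v" using assms(3) no_loops by fastforce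
  have "(\<forall>x z. s (x + axis z 1) = s x \<or> s x = z) \<longleftrightarrow> nonincreasing_in_difference u v s"
  proof
    assume local_change: "\<forall>x z. s (x + axis z 1) = s x \<or> s x = z"
    \<comment> \<open>The profile \<open>d *s axis u 1\<close> represents the difference
      \<open>d\<close>, since \<open>u\<close> and \<open>v\<close> are distinct.\<close>
    define f where "f d = s (d *s axis u 1)" for d
    have "s x = f (x $ u - x $ v)" for x
      unfolding f_def using assms(4,5) local_change \<open>u \<noteq> v\<close>
      by (intro translation_invariant_factors_through_difference) metis+
    \<comment> \<open>Take \<open>z = u\<close> in \<open>local_change\<close>: either the selection
      is unchanged, hence \<open>u\<close>, or it was already \<open>u\<close>.\<close>
    moreover have "f d = u" if "f (d + 1) = u" for d
    proof -
      have "f (d + 1) = s (d *s axis u 1 + axis u 1)"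
        by (simp add: f_def vector_sadd_rdistrib)
      then show ?thesis using that local_change unfolding f_def by metis
    qed
    ultimately show "nonincreasing_in_difference u v s"
      unfolding nonincreasing_in_difference_def antimono_of_bool_int_iff by blast
  next
    assume "nonincreasing_in_difference u v s"
    then obtain f where f: "\<And>x. s x = f (x $ u - x $ v)"
      and step: "\<And>d. f (d + 1) = u \<Longrightarrow> f d = u"
      unfolding nonincreasing_in_difference_def antimono_of_bool_int_iff by blast
    show "\<forall>x z. s (x + axis z 1) = s x \<or> s x = z"
    proof (intro allI)
      fix x :: "int ^ 'v" and z
      let ?d = "x $ u - x $ v"
      have sz: "s (x + axis z 1) = f (?d + (axis z 1 $ u - axis z 1 $ v))"
        by (simp add: f algebra_simps)
      consider "z = u" | "z = v" | "z \<notin> {u, v}" by blast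
      then show "s (x + axis z 1) = s x \<or> s x = z"
      proof cases
        case 1
        then have "s (x + axis z 1) = f (?d + 1)" using sz \<open>u \<noteq> v\<close> by (simp add: axis_def)
        \<comment> \<open>If \<open>s x\<close> is not \<open>u\<close>, it is \<open>v\<close>; by
          \<open>step\<close> the larger difference cannot select \<open>u\<close>, so
          \<open>v\<close> stays selected.\<close>
        then show ?thesis using 1 step[of ?d] f[of x] assms(4) by (metis insertE singletonD)
      next
        case 2
        then have "s (x + axis z 1) = f (?d - 1)" using sz \<open>u \<noteq> v\<close> by (simp add: axis_def)
        \<comment> \<open>Symmetrically, if \<open>u\<close> is selected at the current difference,
          \<open>step\<close> keeps it selected one below.\<close>
        then show ?thesis using 2 step[of "?d - 1"] f[of x] assms(4)
          by (metis diff_add_cancel insertE singletonD)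
      next
        case 3
        then show ?thesis using sz f[of x] by (auto simp: axis_def)
      qed
    qed
  qed
  then show ?thesis by (simp only: assms(2) selector_step_condition_iff)
qed

end
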